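(* Let $\mathcal{P}$ be a finite index set, $\{A_p : p\in\mathcal{P}\}$ a collection of stable real $n\times n$ matrices and $\mathcal{I}=\{I_q : q\in\mathcal{Q}\}$ a compact set of real $n\times n$ matrices. Assume that for some positive constants $\{\tau_p\}_{p\in\mathcal{P}}$ there exists a collection of symmetric positive definite matrices $\{Q_p\in M_n(\mathbb{R}) : p\in\mathcal{P}\}$ such that $$Q_pA_p+A_p^\top Q_p<0\quad\text{for all }p\in\mathcal{P},\qquad e^{A_q^\top\tau_q}M^\top Q_pMe^{A_q\tau_q}\le Q_q\quad\text{for all }p,q\in\mathcal{P}\text{ and }M\in\mathcal{I}.$$ Then for all signals $\sigma\in\mathcal{S}_s^M\left(\{\tau_p\}_{p\in\mathcal{P}}\right)$ the impulsive switched system $\dot x(t)=A_{\sigma(t)}x(t)$, $x(t_k)=I_{\omega(t_k)}\,x(t_k^-)$ ($k\ge1$) is stable under arbitrary impulses, i.e. stable for every function $\omega:\{t_1,t_2,\dots\}\to\mathcal{Q}$.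
   Context: A real matrix is called stable if all its eigenvalues have negative real part. For symmetric matrices, $<$ and $\le$ denote the (strict and non-strict) Loewner order. A switching signal is a right-continuous piecewise constant function $\sigma:[0,\infty)\to\mathcal{P}$ whose set of discontinuities $\{t_k\}_{k\ge1}$ (switching times) is an increasing sequence with $t_k\uparrow\infty$; put $t_0=0$. $\mathcal{S}_s^M(\{\tau_p\}_{p\in\mathcal{P}})$ is the set of switching signals with $t_{k+1}-t_k\ge\tau_{\sigma(t_k)}$ for all $k\ge0$. In the impulsive switched system, $\dot x=A_{\sigma(t)}x$ holds on each $[t_{k-1},t_k)$ and $x(t_k^-)=\lim_{t\to t_k^-}x(t)$. The system (for fixed $\sigma,\omega$) is stable if for every $\epsilon>0$ there is $\delta>0$ such that $\|x(0)\|<\delta$ implies $\|x(t)\|<\epsilon$ for all $t>0$ (Euclidean norm). *)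

theory Defs
  imports "HOL-Analysis.Analysis"
begin

section \<open>Matrices\<close>

text \<open>
  On \<open>real^'n^'n\<close> the operations \<open>*\<close> and \<open>^\<close> of the library are componentwise, and
  \<open>exp\<close> is not available; powers are therefore iterated matrix products. The lemma
  \<open>summable_mat_exp\<close> below shows that the exponential series always converges.
\<close>

definition mat_power :: "real^'n^'n \<Rightarrow> nat \<Rightarrow> real^'n^'n" where
  "mat_power A k = (((**) A) ^^ k) (mat 1)"

definition mat_exp :: "real^'n^'n \<Rightarrow> real^'n^'n" where
  "mat_exp A = (\<Sum>k. (1 / fact k) *\<^sub>R mat_power A k)"

definition complex_eigenvalue :: "real^'n^'n \<Rightarrow> complex \<Rightarrow> bool" where
  "complex_eigenvalue A \<mu> \<longleftrightarrow>
     (\<exists>v::complex^'n. v \<noteq> 0 \<and> map_matrix complex_of_real A *v v = \<mu> *s v)"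

definition stable_matrix :: "real^'n^'n \<Rightarrow> bool" where
  "stable_matrix A \<longleftrightarrow> (\<forall>\<mu>. complex_eigenvalue A \<mu> \<longrightarrow> Re \<mu> < 0)"

definition sym_pos_semidef :: "real^'n^'n \<Rightarrow> bool" where
  "sym_pos_semidef M \<longleftrightarrow> transpose M = M \<and> (\<forall>x. 0 \<le> x \<bullet> (M *v x))"

definition sym_pos_def :: "real^'n^'n \<Rightarrow> bool" where
  "sym_pos_def M \<longleftrightarrow> transpose M = M \<and> (\<forall>x. x \<noteq> 0 \<longrightarrow> 0 < x \<bullet> (M *v x))"

text \<open>
  Loewner order. The relations \<open>\<le>\<close> and \<open><\<close> of the library on \<open>real^'n^'n\<close> are
  componentwise and must not be used for this.
\<close>

definition loewner_le :: "real^'n^'n \<Rightarrow> real^'n^'n \<Rightarrow> bool"  (infix "\<preceq>\<^sub>L" 50) where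
  "M \<preceq>\<^sub>L N \<longleftrightarrow> sym_pos_semidef (N - M)"

definition loewner_less :: "real^'n^'n \<Rightarrow> real^'n^'n \<Rightarrow> bool"  (infix "\<prec>\<^sub>L" 50) where
  "M \<prec>\<^sub>L N \<longleftrightarrow> sym_pos_def (N - M)"


section \<open>Switching signals\<close>

text \<open>
  A signal on $[0,\infty)$ is a function on \<open>real\<close> whose values at negative arguments are
  irrelevant. The index type carries no topology: it is treated as discrete, so
  continuity at a point means being eventually constant there.
\<close>

definition discontinuities :: "(real \<Rightarrow> 'p) \<Rightarrow> real set" where
  "discontinuities \<sigma> = {s. 0 \<le> s \<and> \<not> (\<forall>\<^sub>F r in at s within {0..}. \<sigma> r = \<sigma> s)}"

text \<open>
  \<open>t\<close> enumerates the switching times $t_1 < t_2 < \dots$ of \<open>\<sigma>\<close>, preceded by $t_0 = 0$;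
  it is determined by \<open>\<sigma>\<close> (lemma \<open>switching_times_unique\<close> below).
\<close>

definition switching_times :: "(real \<Rightarrow> 'p) \<Rightarrow> (nat \<Rightarrow> real) \<Rightarrow> bool" where
  "switching_times \<sigma> t \<longleftrightarrow>
     t 0 = 0 \<and> strict_mono t \<and> filterlim t at_top sequentially \<and>
     discontinuities \<sigma> = t ` {1..}"

definition switching_signal :: "'p set \<Rightarrow> (real \<Rightarrow> 'p) \<Rightarrow> bool" where
  "switching_signal P \<sigma> \<longleftrightarrow>
     \<sigma> \<in> {0..} \<rightarrow> P \<and>
     (\<forall>s\<ge>0. \<forall>\<^sub>F r in at_right s. \<sigma> r = \<sigma> s) \<and>
     (\<exists>t. switching_times \<sigma> t \<and> (\<forall>k. \<sigma> constant_on {t k..<t (Suc k)}))"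

text \<open>The set $\mathcal{S}_s^M(\{\tau_p\}_{p \in P})$ of signals with mode-dependent dwell times.\<close>

definition slow_signals :: "'p set \<Rightarrow> ('p \<Rightarrow> real) \<Rightarrow> (real \<Rightarrow> 'p) set" where
  "slow_signals P \<tau> = {\<sigma>. switching_signal P \<sigma> \<and>
     (\<forall>t. switching_times \<sigma> t \<longrightarrow> (\<forall>k. t (Suc k) - t k \<ge> \<tau> (\<sigma> (t k))))}"


section \<open>The impulsive switched system\<close>

text \<open>
  \<open>x\<close> is a trajectory on $[0,\infty)$. Restricting the derivative to
  $[t_k,t_{k+1})$ makes it the right derivative at $t_k$ and the ordinary derivative at
  interior points. The vector \<open>y\<close> is the left limit $x(t_k^-)$.
\<close>

definition impulsive_solution ::
  "('p \<Rightarrow> real^'n^'n) \<Rightarrow> ('q \<Rightarrow> real^'n^'n) \<Rightarrow> (real \<Rightarrow> 'p) \<Rightarrow> (nat \<Rightarrow> real) \<Rightarrow>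
   (real \<Rightarrow> 'q) \<Rightarrow> (real \<Rightarrow> real^'n) \<Rightarrow> bool" where
  "impulsive_solution A J \<sigma> t \<omega> x \<longleftrightarrow>
     (\<forall>k. \<forall>s\<in>{t k..<t (Suc k)}.
        (x has_vector_derivative (A (\<sigma> s) *v x s)) (at s within {t k..<t (Suc k)})) \<and>
     (\<forall>k\<ge>1. \<exists>y. (x \<longlongrightarrow> y) (at_left (t k)) \<and> x (t k) = J (\<omega> (t k)) *v y)"

definition stable_system ::
  "('p \<Rightarrow> real^'n^'n) \<Rightarrow> ('q \<Rightarrow> real^'n^'n) \<Rightarrow> (real \<Rightarrow> 'p) \<Rightarrow> (nat \<Rightarrow> real) \<Rightarrow>
   (real \<Rightarrow> 'q) \<Rightarrow> bool" where
  "stable_system A J \<sigma> t \<omega> \<longleftrightarrow>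
     (\<forall>\<epsilon>>0. \<exists>\<delta>>0. \<forall>x. impulsive_solution A J \<sigma> t \<omega> x \<longrightarrow> norm (x 0) < \<delta> \<longrightarrow>
        (\<forall>s>0. norm (x s) < \<epsilon>))"

definition stable_under_arbitrary_impulses ::
  "('p \<Rightarrow> real^'n^'n) \<Rightarrow> 'q set \<Rightarrow> ('q \<Rightarrow> real^'n^'n) \<Rightarrow> (real \<Rightarrow> 'p) \<Rightarrow> bool" where
  "stable_under_arbitrary_impulses A Q J \<sigma> \<longleftrightarrow>
     (\<forall>t \<omega>. switching_times \<sigma> t \<longrightarrow> \<omega> \<in> t ` {1..} \<rightarrow> Q \<longrightarrow> stable_system A J \<sigma> t \<omega>)"


section \<open>Well-definedness\<close>

lemma mat_power_Suc: "mat_power A (Suc k) = A ** mat_power A k"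
  by (simp add: mat_power_def)

lemma mat_power_entry_bound:
  fixes A :: "real^'n^'n"
  assumes c: "\<And>i j. \<bar>A $ i $ j\<bar> \<le> c"
  shows "\<bar>mat_power A k $ i $ j\<bar> \<le> (real CARD('n) * c) ^ k"
proof (induction k arbitrary: i j)
  case 0
  then show ?case by (simp add: mat_power_def mat_def)
next
  case (Suc k)
  have c0: "0 \<le> c" using c[of i j] by linarith
  have "\<bar>mat_power A (Suc k) $ i $ j\<bar> = \<bar>\<Sum>l\<in>UNIV. A $ i $ l * mat_power A k $ l $ j\<bar>"
    by (simp add: mat_power_Suc matrix_matrix_mult_def)
  also have "\<dots> \<le> (\<Sum>l\<in>(UNIV::'n set). \<bar>A $ i $ l * mat_power A k $ l $ j\<bar>)"
    by (rule sum_abs)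
  also have "\<dots> \<le> (\<Sum>l\<in>(UNIV::'n set). c * (real CARD('n) * c) ^ k)"
    by (intro sum_mono) (simp add: abs_mult mult_mono c c0 Suc.IH)
  finally show ?case by (simp add: mult_ac)
qed

lemma summable_mat_exp:
  fixes A :: "real^'n^'n"
  shows "summable (\<lambda>k. (1 / fact k) *\<^sub>R mat_power A k)"
proof -
  define c where "c = norm A"
  have c: "\<bar>A $ i $ j\<bar> \<le> c" for i j
  proof -
    have "\<bar>A $ i $ j\<bar> \<le> norm (A $ i)" by (rule component_le_norm_cart)
    also have "\<dots> \<le> norm A" by (rule Finite_Cartesian_Product.norm_nth_le)
    finally show ?thesis by (simp add: c_def)
  qed
  define N where "N = real CARD('n)"
  have nrm: "norm (mat_power A k) \<le> N * (N * (N * c) ^ k)" for k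
  proof -
    have "norm (mat_power A k) \<le> (\<Sum>i\<in>UNIV. norm (mat_power A k $ i))"
      unfolding norm_vec_def by (rule L2_set_le_sum) simp
    also have "\<dots> \<le> (\<Sum>i\<in>(UNIV::'n set). N * (N * c) ^ k)"
    proof (rule sum_mono)
      fix i :: 'n
      have "norm (mat_power A k $ i) \<le> (\<Sum>j\<in>UNIV. \<bar>mat_power A k $ i $ j\<bar>)"
        by (rule norm_le_l1_cart)
      also have "\<dots> \<le> (\<Sum>j\<in>(UNIV::'n set). (N * c) ^ k)"
        unfolding N_def by (intro sum_mono mat_power_entry_bound c)
      finally show "norm (mat_power A k $ i) \<le> N * (N * c) ^ k" by (simp add: N_def)
    qed
    finally show ?thesis by (simp add: N_def)
  qed
  have "summable (\<lambda>k. inverse (fact k) * (N * c) ^ k)"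
    by (rule summable_exp)
  then have S: "summable (\<lambda>k. N * N * (inverse (fact k) * (N * c) ^ k))"
    by (rule summable_mult)
  show ?thesis
  proof (rule summable_comparison_test'[OF S, of 0])
    fix k :: nat
    show "norm ((1 / fact k) *\<^sub>R mat_power A k) \<le> N * N * (inverse (fact k) * (N * c) ^ k)"
      using nrm[of k] by (simp add: field_simps)
  qed
qed

lemma switching_times_unique:
  assumes t: "switching_times \<sigma> t" and u: "switching_times \<sigma> u"
  shows "t = u"
proof -
  have r: "t ` {1..} = u ` {1..}" and z: "t 0 = u 0" and m: "strict_mono t" "strict_mono u"
    using t u by (auto simp: switching_times_def)
  have rr: "range v = insert (v 0) (v ` {1..})" for v :: "nat \<Rightarrow> real"
  proof -
    have "(UNIV :: nat set) = insert 0 {1..}" by auto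
    then show ?thesis by (metis image_insert)
  qed
  have R: "range t = range u" using r z rr[of t] rr[of u] by simp
  have le: "v k \<le> w k" if v: "strict_mono v" and w: "strict_mono w"
    and vw: "range v = range w" and eq: "\<And>j. j < k \<Longrightarrow> v j = w j" for v w :: "nat \<Rightarrow> real" and k
  proof -
    obtain i where i: "w k = v i" using vw by (metis rangeE rangeI)
    have "\<not> i < k"
    proof
      assume "i < k"
      then have "w k = w i" using i eq by simp
      then show False using \<open>i < k\<close> strict_monoD[OF w, of i k] by simp
    qed
    then show ?thesis using i strict_mono_less_eq[OF v, of k i] by simp
  qed
  have "t k = u k" for k
  proof (induction k rule: less_induct)
    case (less k)
    have "t k \<le> u k" by (rule le[OF m R less.IH])
    moreover have "u k \<le> t k" by (rule le[OF m(2,1) R[symmetric] less.IH[symmetric]])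
    ultimately show ?case by simp
  qed
  then show ?thesis by blast
qed

end

theory Submission
  imports Defs
begin

text \<open>
  Write $V_p(v) = v^\top Q_p v$. While mode $q$ is active, $V_q$ decreases along the trajectory.
  Since mode $q$ lasts for at least $\tau_q$, the state just before the next jump is
  $e^{A_q \tau_q} z$, where $z$ is the state $\tau_q$ time units earlier; the second matrix
  inequality therefore bounds $V_p$ after the jump into mode $p$ by $V_q(z)$, and hence by the
  value of $V_q$ when mode $q$ was entered. So $V_{\sigma(t)}(x(t))$ never exceeds its initial value, and
  the finitely many forms $V_p$ are uniformly comparable with the squared norm.
\<close>

section \<open>The matrix exponential\<close>

lemma mat_power_scaleR: "mat_power (r *\<^sub>R A) k = r ^ k *\<^sub>R mat_power A k"
  by (induction k)
    (simp_all add: mat_power_Suc mat_power_def[where k=0] scalar_matrix_assoc[symmetric] matrix_scalar_ac mult.commute)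

lemma mat_power_Suc_right: "mat_power A (Suc k) = mat_power A k ** A"
proof (induction k)
  case 0
  show ?case by (simp add: mat_power_def)
next
  case (Suc k)
  then show ?case by (metis mat_power_Suc matrix_mul_assoc)
qed

lemma mat_power_transpose: "mat_power (transpose A) k = transpose (mat_power A k)"
proof (induction k)
  case 0
  show ?case by (simp add: mat_power_def)
next
  case (Suc k)
  then show ?case
    by (simp add: mat_power_Suc mat_power_Suc_right[symmetric] matrix_transpose_mul[symmetric])
qed

text \<open>Taking an entry is bounded linear, so it passes through the convergent series. Working
  entrywise reduces the calculus of the exponential to real power series.\<close>

lemma mat_exp_nth_sums: "(\<lambda>k. mat_power A k $ i $ j / fact k) sums (mat_exp A $ i $ j)"
proof -
  have "(\<lambda>k. (1 / fact k) *\<^sub>R mat_power A k) sums mat_exp A"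
    unfolding mat_exp_def by (rule summable_sums[OF summable_mat_exp])
  then have "(\<lambda>k. ((1 / fact k) *\<^sub>R mat_power A k) $ i $ j) sums (mat_exp A $ i $ j)"
    by (intro bounded_linear.sums[OF bounded_linear_vec_nth])
  then show ?thesis by simp
qed

text \<open>Transposition commutes with every power, hence with the series. This is what brings the
  second matrix inequality, with \<open>transpose (A q)\<close> inside an exponential, into
  congruence form.\<close>

lemma mat_exp_transpose: "mat_exp (transpose A) = transpose (mat_exp A)"
proof -
  have "mat_exp (transpose A) $ i $ j = mat_exp A $ j $ i" for i j
    using mat_exp_nth_sums[of "transpose A" i j] mat_exp_nth_sums[of A j i]
    unfolding mat_power_transpose by (simp add: transpose_def sums_unique2)
  then show ?thesis by (simp add: vec_eq_iff transpose_def)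
qed

lemma mat_exp_0: "mat_exp (0 :: real^'n^'n) = mat 1"
proof -
  have "mat_exp (0 :: real^'n^'n) $ i $ j = mat 1 $ i $ j" for i j
  proof -
    \<comment> \<open>Since \<open>0 ^ 0 = 1\<close>, this form makes each entry a power series
      evaluated at 0, which leaves only its constant term.\<close>
    have "mat_power (0 :: real^'n^'n) k = 0 ^ k *\<^sub>R mat 1" for k
      using mat_power_scaleR[of 0 "0 :: real^'n^'n" k] by (cases k) (auto simp: mat_power_def)
    then have "(\<lambda>k. (mat 1 :: real^'n^'n) $ i $ j / fact k * 0 ^ k) sums (mat_exp (0 :: real^'n^'n) $ i $ j)"
      using mat_exp_nth_sums[of "0 :: real^'n^'n" i j] by (simp add: mult_ac)
    from sums_unique2[OF this powser_sums_zero] show ?thesis by simp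
  qed
  then show ?thesis by (simp add: vec_eq_iff)
qed

text \<open>Each entry is a power series in \<open>r\<close> converging everywhere, so it may be
  differentiated term by term.\<close>

lemma mat_exp_nth_has_derivative:
  fixes A :: "real^'n^'n"
  shows "((\<lambda>r. mat_exp (r *\<^sub>R A) $ i $ j) has_field_derivative (mat_exp (r *\<^sub>R A) ** A) $ i $ j) (at r)"
proof -
  define c where "c = (\<lambda>k. mat_power A k $ i $ j / fact k)"
  have S: "(\<lambda>k. mat_power A k $ i $ l / fact k * s ^ k) sums (mat_exp (s *\<^sub>R A) $ i $ l)" for s l
    using mat_exp_nth_sums[of "s *\<^sub>R A" i l] by (simp add: mat_power_scaleR mult_ac)
  \<comment> \<open>The factor \<open>Suc k\<close> produced by differentiation cancels against
    \<open>fact (Suc k)\<close>; the surplus factor \<open>A\<close> is split off on the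
    right.\<close>
  have D: "diffs c k = (\<Sum>l\<in>UNIV. mat_power A k $ i $ l / fact k * A $ l $ j)" for k
  proof -
    have "diffs c k = mat_power A (Suc k) $ i $ j / fact k"
      by (simp add: diffs_def c_def field_simps del: of_nat_Suc)
    then show ?thesis
      by (simp add: mat_power_Suc_right matrix_matrix_mult_def sum_divide_distrib)
  qed
  have "(\<lambda>k. \<Sum>l\<in>UNIV. (mat_power A k $ i $ l / fact k * r ^ k) * A $ l $ j) sums
          (\<Sum>l\<in>UNIV. mat_exp (r *\<^sub>R A) $ i $ l * A $ l $ j)"
    by (intro sums_sum sums_mult2 S)
  then have "(\<lambda>k. diffs c k * r ^ k) sums ((mat_exp (r *\<^sub>R A) ** A) $ i $ j)"
    by (simp add: D sum_distrib_left sum_distrib_right matrix_matrix_mult_def mult_ac)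
  moreover have "((\<lambda>r. \<Sum>k. c k * r ^ k) has_field_derivative (\<Sum>k. diffs c k * r ^ k)) (at r)"
    using S sums_summable unfolding c_def by (intro termdiffs_strong_converges_everywhere) blast
  moreover have "(\<lambda>r. \<Sum>k. c k * r ^ k) = (\<lambda>r. mat_exp (r *\<^sub>R A) $ i $ j)"
    unfolding c_def by (intro ext sums_unique[OF S, symmetric])
  ultimately show ?thesis by (simp add: sums_iff)
qed

section \<open>Linear differential equations\<close>

lemma inner_transpose_matrix: "v \<bullet> (transpose B *v w) = (B *v v) \<bullet> w" for B :: "real^'n^'m"
  by (metis dot_lmul_matrix vector_transpose_matrix)

text \<open>The product e^{(b-r)A} x(r) is constant in r on the interval, and letting r tend to b
  from the left identifies the constant as \<open>y\<close>. The left limit is used instead of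
  \<open>x b\<close> because the trajectory may jump at \<open>b\<close>.\<close>

lemma linear_ode_left_limit:
  fixes A :: "real^'n^'n"
  assumes ode: "\<And>s. s \<in> {a..<b} \<Longrightarrow> (x has_vector_derivative A *v x s) (at s within {a..<b})"
    and lim: "(x \<longlongrightarrow> y) (at_left b)" and s: "s \<in> {a..<b}"
  shows "y = mat_exp ((b - s) *\<^sub>R A) *v x s"
proof -
  define u where "u = (\<lambda>r. mat_exp ((b - r) *\<^sub>R A) *v x r)"
  have u_nth: "u r $ i = (\<Sum>j\<in>UNIV. mat_exp ((b - r) *\<^sub>R A) $ i $ j * x r $ j)" for r i
    by (simp add: u_def matrix_vector_mult_def)
  have "y $ i = u s $ i" for i
  proof -
    have der: "((\<lambda>r. u r $ i) has_field_derivative 0) (at r within {a..<b})" if r: "r \<in> {a..<b}" for r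
    proof -
      define E where "E = mat_exp ((b - r) *\<^sub>R A)"
      have x: "((\<lambda>r. x r $ j) has_field_derivative (A *v x r) $ j) (at r within {a..<b})" for j
        using bounded_linear.has_vector_derivative[OF bounded_linear_vec_nth ode[OF r]]
        by (simp add: has_real_derivative_iff_has_vector_derivative)
      have e: "((\<lambda>r. mat_exp ((b - r) *\<^sub>R A) $ i $ j) has_field_derivative - ((E ** A) $ i $ j))
          (at r within {a..<b})" for j
        unfolding E_def
        by (rule DERIV_chain2[OF mat_exp_nth_has_derivative, THEN DERIV_cong])
          (auto intro!: derivative_eq_intros)
      have "((\<lambda>r. u r $ i) has_field_derivative
          (\<Sum>j\<in>UNIV. - ((E ** A) $ i $ j) * x r $ j + (A *v x r) $ j * E $ i $ j)) (at r within {a..<b})"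
        unfolding u_nth E_def by (intro DERIV_sum DERIV_mult x e[unfolded E_def])
      \<comment> \<open>The two halves of the product rule are E(Ax) and -(EA)x, which cancel by
        associativity.\<close>
      moreover have "(\<Sum>j\<in>UNIV. - ((E ** A) $ i $ j) * x r $ j + (A *v x r) $ j * E $ i $ j)
          = (E *v (A *v x r)) $ i - ((E ** A) *v x r) $ i"
        by (simp add: matrix_vector_mult_def[of E] matrix_vector_mult_def[of "E ** A"]
            sum.distrib sum_negf sum_subtractf mult.commute)
      ultimately show ?thesis by (simp add: matrix_vector_mul_assoc)
    qed
    obtain c where c: "\<And>r. r \<in> {a..<b} \<Longrightarrow> u r $ i = c"
      using has_field_derivative_zero_constant[OF convex_real_interval(7) der] by metis
    have "((\<lambda>r. mat_exp ((b - r) *\<^sub>R A) $ i $ j) \<longlongrightarrow> mat_exp 0 $ i $ j) (at_left b)" for j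
    proof -
      have "isCont (\<lambda>r. mat_exp (r *\<^sub>R A) $ i $ j) (b - b)"
        by (rule DERIV_isCont[OF mat_exp_nth_has_derivative])
      moreover have "((\<lambda>r. b - r) \<longlongrightarrow> b - b) (at_left b)" by (intro tendsto_intros)
      ultimately show ?thesis
        using isCont_tendsto_compose by fastforce
    qed
    then have "((\<lambda>r. u r $ i) \<longlongrightarrow> (\<Sum>j\<in>UNIV. mat_exp 0 $ i $ j * y $ j)) (at_left b)"
      unfolding u_nth by (intro tendsto_sum tendsto_mult tendsto_vec_nth[OF lim])
    then have "((\<lambda>r. u r $ i) \<longlongrightarrow> y $ i) (at_left b)"
      using matrix_vector_mul_lid[of y] by (simp add: mat_exp_0 matrix_vector_mult_def vec_eq_iff)
    moreover have "\<forall>\<^sub>F r in at_left b. u r $ i = c"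
      using eventually_at_left[of a b] s c by (auto intro!: exI[of _ a])
    ultimately have "y $ i = c"
      by (intro tendsto_unique[OF trivial_limit_at_left_real _ tendsto_eventually])
    then show ?thesis using c[OF s] by simp
  qed
  then show ?thesis by (simp add: vec_eq_iff u_def)
qed

text \<open>Along the flow the derivative of the form is v^T (QA + A^T Q) v with v the current
  state, and this is nonpositive.\<close>

lemma quadratic_form_antimono_linear_ode:
  fixes A Q :: "real^'n^'n"
  assumes neg: "Q ** A + transpose A ** Q \<prec>\<^sub>L 0"
    and ode: "\<And>s. s \<in> {a..<b} \<Longrightarrow> (x has_vector_derivative A *v x s) (at s within {a..<b})"
    and s: "a \<le> s" "s < b"
  shows "x s \<bullet> (Q *v x s) \<le> x a \<bullet> (Q *v x a)"
proof -
  define f where "f = (\<lambda>r. x r \<bullet> (Q *v x r))"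
  define D where "D = (\<lambda>v. v \<bullet> (Q *v (A *v v)) + (A *v v) \<bullet> (Q *v v))"
  have der: "(f has_field_derivative D (x r)) (at r within {a..<b})" if r: "r \<in> {a..<b}" for r
  proof -
    have "((\<lambda>r. Q *v x r) has_vector_derivative Q *v (A *v x r)) (at r within {a..<b})"
      by (rule bounded_linear.has_vector_derivative[OF matrix_vector_mul_bounded_linear ode[OF r]])
    from bounded_bilinear.has_vector_derivative[OF bounded_bilinear_inner ode[OF r] this]
    show ?thesis
      by (simp add: f_def D_def has_real_derivative_iff_has_vector_derivative)
  qed
  have nonpos: "D v \<le> 0" for v
  proof -
    have "(A *v v) \<bullet> (Q *v v) = v \<bullet> (transpose A *v (Q *v v))"
      by (rule inner_transpose_matrix[symmetric])
    then have "D v = - (v \<bullet> ((0 - (Q ** A + transpose A ** Q)) *v v))"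
      unfolding matrix_vector_mult_diff_rdistrib
      by (simp add: D_def matrix_vector_mult_add_rdistrib
          matrix_vector_mul_assoc inner_right_distrib inner_diff_right)
    then show ?thesis
      using neg unfolding loewner_less_def sym_pos_def_def by (cases "v = 0") (auto simp: D_def intro: less_imp_le)
  qed
  have "f s \<le> f a"
  \<comment> \<open>At \<open>a\<close> only a one-sided derivative is available, so the criterion
    used asks for derivatives in the open interval and mere continuity at the endpoints.\<close>
  proof (rule DERIV_nonpos_imp_decreasing_open[OF s(1)])
    fix r assume r: "a < r" "r < s"
    then have "at r within {a..<b} = at r"
      using s by (intro at_within_interior) auto
    then show "\<exists>y. (f has_real_derivative y) (at r) \<and> y \<le> 0"
      using der[of r] nonpos r s by auto
  next
    have "continuous_on {a..<b} f"
      unfolding continuous_on_eq_continuous_within using der DERIV_continuous by blast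
    then show "continuous_on {a..s} f"
      by (rule continuous_on_subset) (use s in auto)
  qed
  then show ?thesis by (simp add: f_def)
qed

section \<open>Quadratic forms\<close>

text \<open>The form attains a minimum on the compact unit sphere, positive by definiteness;
  homogeneity of degree two extends the bound to all vectors.\<close>

lemma sym_pos_def_lower_bound:
  fixes Q :: "real^'n^'n"
  assumes "sym_pos_def Q"
  obtains c where "0 < c" "\<And>v. c * (norm v)\<^sup>2 \<le> v \<bullet> (Q *v v)"
proof -
  have "\<exists>w\<in>sphere 0 1. \<forall>v\<in>sphere 0 1. w \<bullet> (Q *v w) \<le> v \<bullet> (Q *v v)"
  proof (rule continuous_attains_inf)
    show "sphere (0 :: real^'n) 1 \<noteq> {}" by simp
    show "continuous_on (sphere 0 1) (\<lambda>v. v \<bullet> (Q *v v))"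
      by (intro continuous_intros linear_continuous_on matrix_vector_mul_bounded_linear)
  qed simp
  then obtain w where w: "norm w = 1" and min: "\<And>v. norm v = 1 \<Longrightarrow> w \<bullet> (Q *v w) \<le> v \<bullet> (Q *v v)"
    by auto
  show thesis
  proof
    show "0 < w \<bullet> (Q *v w)"
      using w assms unfolding sym_pos_def_def by (metis norm_zero zero_neq_one)
    show "w \<bullet> (Q *v w) * (norm v)\<^sup>2 \<le> v \<bullet> (Q *v v)" for v
    proof (cases "v = 0")
      case False
      have "w \<bullet> (Q *v w) \<le> (v /\<^sub>R norm v) \<bullet> (Q *v (v /\<^sub>R norm v))"
        using False by (intro min) simp
      also have "\<dots> = v \<bullet> (Q *v v) / (norm v)\<^sup>2"
        by (simp add: matrix_vector_mult_scaleR power2_eq_square field_simps)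
      finally show ?thesis
        using False by (simp add: field_simps)
    qed simp
  qed
qed

lemma quadratic_form_upper_bound:
  fixes Q :: "real^'n^'n"
  obtains K where "0 < K" "\<And>v. v \<bullet> (Q *v v) \<le> K * (norm v)\<^sup>2"
proof -
  obtain K where K: "0 < K" "\<And>v. norm (Q *v v) \<le> norm v * K"
    using bounded_linear.pos_bounded[OF matrix_vector_mul_bounded_linear[of Q]] by blast
  have "v \<bullet> (Q *v v) \<le> K * (norm v)\<^sup>2" for v
  proof -
    have "v \<bullet> (Q *v v) \<le> norm v * norm (Q *v v)" by (rule norm_cauchy_schwarz)
    also have "\<dots> \<le> norm v * (norm v * K)" by (intro mult_left_mono K) simp
    finally show ?thesis by (simp add: power2_eq_square mult_ac)
  qed
  with K(1) show thesis by (rule that)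
qed

lemma inner_conjugate_matrix:
  fixes B Q :: "real^'n^'n"
  shows "v \<bullet> ((transpose B ** Q ** B) *v v) = (B *v v) \<bullet> (Q *v (B *v v))"
  by (metis inner_transpose_matrix matrix_vector_mul_assoc)

section \<open>Stability\<close>

text \<open>As the times diverge, there is a least \<open>n\<close> with \<open>s < t n\<close>. It
  is not 0 because \<open>t 0 = 0\<close>, and its predecessor is the required index.\<close>

lemma switching_times_interval:
  assumes "switching_times \<sigma> t" "0 \<le> s"
  obtains k where "s \<in> {t k..<t (Suc k)}"
proof -
  have "\<exists>n. s < t n"
    using assms unfolding switching_times_def
    by (metis eventually_sequentially filterlim_at_top_dense order_refl)
  then have less: "s < t (LEAST n. s < t n)" by (rule LeastI_ex)
  then have "(LEAST n. s < t n) \<noteq> 0"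
    using assms unfolding switching_times_def by (metis not_less)
  then obtain k where k: "(LEAST n. s < t n) = Suc k" by (metis not0_implies_Suc)
  moreover have "t k \<le> s"
    using not_less_Least[of k "\<lambda>n. s < t n"] k by auto
  ultimately show thesis using less by (intro that[of k]) auto
qed

theorem theorem6p4:
  fixes P :: "'p set" and A :: "'p \<Rightarrow> real^'n^'n"
    and \<Q> :: "'q set" and J :: "'q \<Rightarrow> real^'n^'n"
    and \<tau> :: "'p \<Rightarrow> real" and Q :: "'p \<Rightarrow> real^'n^'n"
  assumes "finite P"
    and "\<forall>p\<in>P. stable_matrix (A p)"
    and "compact (J ` \<Q>)"
    and "\<forall>p\<in>P. 0 < \<tau> p"
    and "\<forall>p\<in>P. sym_pos_def (Q p)"
    and "\<forall>p\<in>P. Q p ** A p + transpose (A p) ** Q p \<prec>\<^sub>L 0"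
    and "\<forall>p\<in>P. \<forall>q\<in>P. \<forall>M \<in> J ` \<Q>.
           mat_exp (\<tau> q *\<^sub>R transpose (A q)) ** transpose M ** Q p ** M ** mat_exp (\<tau> q *\<^sub>R A q)
             \<preceq>\<^sub>L Q q"
  shows "\<forall>\<sigma> \<in> slow_signals P \<tau>. stable_under_arbitrary_impulses A \<Q> J \<sigma>"
proof
  fix \<sigma> assume \<sigma>: "\<sigma> \<in> slow_signals P \<tau>"
  then have in_P: "\<sigma> s \<in> P" if "0 \<le> s" for s
    using that by (auto simp: slow_signals_def switching_signal_def)
  define V where "V = (\<lambda>p v. v \<bullet> (Q p *v v))"
  have "\<exists>c. 0 < c \<and> (\<forall>v. c * (norm v)\<^sup>2 \<le> V p v)" if "p \<in> P" for p
    using sym_pos_def_lower_bound[of "Q p"] assms(5) that unfolding V_def by metis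
  then obtain c where c: "\<And>p. p \<in> P \<Longrightarrow> 0 < c p" "\<And>p v. p \<in> P \<Longrightarrow> c p * (norm v)\<^sup>2 \<le> V p v"
    by metis
  \<comment> \<open>Finiteness of \<open>P\<close> yields one coercivity constant for all modes;
    \<open>P\<close> is nonempty because it contains \<open>\<sigma> 0\<close>.\<close>
  define m where "m = Min (c ` P)"
  have m_pos: "0 < m"
    unfolding m_def using in_P[of 0] assms(1) c(1) by (subst Min_gr_iff) auto
  have m_le: "m * (norm v)\<^sup>2 \<le> V p v" if "p \<in> P" for p v
  proof -
    have "m \<le> c p" using assms(1) that by (simp add: m_def)
    then show ?thesis using c(2)[OF that, of v] by (meson mult_right_mono order_trans zero_le_power2)
  qed
  \<comment> \<open>An upper bound for the initial mode suffices, since later values are all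
    compared with the initial one.\<close>
  obtain K where K: "0 < K" "\<And>v. V (\<sigma> 0) v \<le> K * (norm v)\<^sup>2"
    using quadratic_form_upper_bound[of "Q (\<sigma> 0)"] unfolding V_def by metis
  \<comment> \<open>The second matrix inequality evaluated at \<open>z\<close>: flow in mode
    \<open>q\<close> for time \<open>\<tau> q\<close>, then an impulse and a switch to mode
    \<open>p\<close>.\<close>
  have jump: "V p (J i *v (mat_exp (\<tau> q *\<^sub>R A q) *v z)) \<le> V q z"
    if "p \<in> P" "q \<in> P" "i \<in> \<Q>" for p q i z
  proof -
    let ?E = "mat_exp (\<tau> q *\<^sub>R A q)"
    have E: "mat_exp (\<tau> q *\<^sub>R transpose (A q)) = transpose ?E"
      by (metis mat_exp_transpose transpose_scalar)
    have "mat_exp (\<tau> q *\<^sub>R transpose (A q)) ** transpose (J i) ** Q p ** J i ** ?E \<preceq>\<^sub>L Q q"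
      using assms(7) that by blast
    then have "transpose (J i ** ?E) ** Q p ** (J i ** ?E) \<preceq>\<^sub>L Q q"
      unfolding E by (simp add: matrix_transpose_mul matrix_mul_assoc)
    then have "0 \<le> z \<bullet> ((Q q - transpose (J i ** ?E) ** Q p ** (J i ** ?E)) *v z)"
      unfolding loewner_le_def sym_pos_semidef_def by blast
    then have "z \<bullet> ((transpose (J i ** ?E) ** Q p ** (J i ** ?E)) *v z) \<le> z \<bullet> (Q q *v z)"
      by (simp add: matrix_vector_mult_diff_rdistrib inner_diff_right)
    then show ?thesis
      by (simp add: V_def inner_conjugate_matrix matrix_vector_mul_assoc)
  qed
  have "stable_system A J \<sigma> t \<omega>" if t: "switching_times \<sigma> t" and \<omega>: "\<omega> \<in> t ` {1..} \<rightarrow> \<Q>" for t \<omega>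
  proof -
    have t0: "t 0 = 0" and mono: "strict_mono t"
      using t by (auto simp: switching_times_def)
    have t_nonneg: "0 \<le> t k" for k
      using strict_mono_less_eq[OF mono, of 0 k] t0 by simp
    have const: "\<sigma> s = \<sigma> (t k)" if "s \<in> {t k..<t (Suc k)}" for s k
    proof -
      \<comment> \<open>The signal is constant between the times of some enumeration
        \<open>u\<close>; uniqueness of switching times identifies it with the given
        \<open>t\<close>.\<close>
      obtain u where u: "switching_times \<sigma> u" "\<And>k. \<sigma> constant_on {u k..<u (Suc k)}"
        using \<sigma> by (auto simp: slow_signals_def switching_signal_def)
      then have "\<sigma> constant_on {t k..<t (Suc k)}"
        using switching_times_unique[OF t u(1)] by simp
      then show ?thesis using that by (force simp: constant_on_def)
    qed
    have dwell: "\<tau> (\<sigma> (t k)) \<le> t (Suc k) - t k" for k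
      using \<sigma> t by (auto simp: slow_signals_def)
    \<comment> \<open>Neither constant depends on the trajectory or on \<open>s\<close>, which is
      what allows a uniform \<open>\<delta>\<close>.\<close>
    have bound: "m * (norm (x s))\<^sup>2 \<le> K * (norm (x 0))\<^sup>2"
      if x: "impulsive_solution A J \<sigma> t \<omega> x" and s: "0 \<le> s" for x s
    proof -
      have ode: "(x has_vector_derivative A (\<sigma> (t k)) *v x s) (at s within {t k..<t (Suc k)})"
        if "s \<in> {t k..<t (Suc k)}" for k s
        using x that unfolding const[OF that, symmetric] impulsive_solution_def by blast
      have flow: "V (\<sigma> (t k)) (x s) \<le> V (\<sigma> (t k)) (x (t k))" if "s \<in> {t k..<t (Suc k)}" for k s
        unfolding V_def
        using that in_P[OF t_nonneg[of k]] assms(6)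
        by (intro quadratic_form_antimono_linear_ode[OF _ ode]) auto
      have V_switch: "V (\<sigma> (t k)) (x (t k)) \<le> V (\<sigma> 0) (x 0)" for k
      proof (induction k)
        case 0
        show ?case by (simp add: t0)
      next
        case (Suc k)
        define q where "q = \<sigma> (t k)"
        have q: "q \<in> P" by (simp add: q_def in_P t_nonneg)
        \<comment> \<open>The dwell time gives \<open>t k \<le> r\<close> and positivity of
          \<open>\<tau> q\<close> gives \<open>r < t (Suc k)\<close>. The flow from \<open>r\<close>
          to the next switch then lasts exactly \<open>\<tau> q\<close>, as \<open>jump\<close>
          requires.\<close>
        define r where "r = t (Suc k) - \<tau> q"
        have r: "r \<in> {t k..<t (Suc k)}"
          using dwell[of k] assms(4) q by (auto simp: r_def q_def)
        obtain y where y: "(x \<longlongrightarrow> y) (at_left (t (Suc k)))"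
          and x_jump: "x (t (Suc k)) = J (\<omega> (t (Suc k))) *v y"
          using x by (auto simp: impulsive_solution_def dest!: spec[of _ "Suc k"])
        have "y = mat_exp (\<tau> q *\<^sub>R A q) *v x r"
          using linear_ode_left_limit[OF ode y r] by (simp add: r_def q_def)
        moreover have "\<omega> (t (Suc k)) \<in> \<Q>"
          using \<omega> by auto
        ultimately have "V (\<sigma> (t (Suc k))) (x (t (Suc k))) \<le> V q (x r)"
          using jump[OF in_P[OF t_nonneg] q] x_jump by simp
        \<comment> \<open>Any time spent in mode \<open>q\<close> beyond its minimal dwell time is
          absorbed by the decrease of the form from \<open>t k\<close> to \<open>r\<close>.\<close>
        also have "\<dots> \<le> V q (x (t k))"
          unfolding q_def by (rule flow[OF r])
        finally show ?case using Suc.IH by (simp add: q_def)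
      qed
      obtain k where k: "s \<in> {t k..<t (Suc k)}"
        using switching_times_interval[OF t s] .
      have "m * (norm (x s))\<^sup>2 \<le> V (\<sigma> (t k)) (x s)"
        by (rule m_le[OF in_P[OF t_nonneg]])
      also have "\<dots> \<le> K * (norm (x 0))\<^sup>2"
        using flow[OF k] V_switch[of k] K(2)[of "x 0"] by linarith
      finally show ?thesis .
    qed
    show ?thesis
      unfolding stable_system_def
    proof (intro allI impI)
      fix \<epsilon> :: real assume \<epsilon>: "0 < \<epsilon>"
      \<comment> \<open>Chosen so that K \<delta>^2 = m \<epsilon>^2.\<close>
      define \<delta> where "\<delta> = sqrt (m / K) * \<epsilon>"
      have "norm (x s) < \<epsilon>"
        if x: "impulsive_solution A J \<sigma> t \<omega> x" "norm (x 0) < \<delta>" and s: "0 < s" for x s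
      proof -
        have "(norm (x 0))\<^sup>2 < \<delta>\<^sup>2"
          using x(2) by (rule power_strict_mono) auto
        then have "K * (norm (x 0))\<^sup>2 < m * \<epsilon>\<^sup>2"
          using K(1) m_pos by (simp add: \<delta>_def power_mult_distrib field_simps)
        then have "m * (norm (x s))\<^sup>2 < m * \<epsilon>\<^sup>2"
          using bound[OF x(1), of s] s by linarith
        then have "(norm (x s))\<^sup>2 < \<epsilon>\<^sup>2"
          using m_pos by simp
        then show ?thesis
          by (rule power2_less_imp_less) (use \<epsilon> in simp)
      qed
      moreover have "0 < \<delta>" using m_pos K(1) \<epsilon> by (simp add: \<delta>_def)
      ultimately show "\<exists>\<delta>>0. \<forall>x. impulsive_solution A J \<sigma> t \<omega> x \<longrightarrow> norm (x 0) < \<delta> \<longrightarrow>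
          (\<forall>s>0. norm (x s) < \<epsilon>)"
        by blast
    qed
  qed
  then show "stable_under_arbitrary_impulses A \<Q> J \<sigma>"
    by (simp add: stable_under_arbitrary_impulses_def)
qed

end
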